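(* Let $1\ge\alpha>\beta>\gamma>0$, $\lambda_1,\lambda_2,\lambda_3\in\mathbb{R}$, and let $g\in C([0,\infty),\mathbb{R})$. A solution $\tilde{y}\in C^{1}([0,\infty),\mathbb{R})$ of $$\left({}^{C}D^{\alpha}_{0^+}y\right)(r)-\lambda_{3}\left({}^{C}D^{\beta}_{0^+}y\right)(r)-\lambda_{2}\left({}^{C}D^{\gamma}_{0^+}y\right)(r)-\lambda_{1}y(r)=g(r),\quad r>0,$$ satisfying the homogeneous initial condition $y(0)=0$ has the form $$\tilde{y}(r)=\int_{0}^{r}(r-s)^{\alpha-1}E_{\alpha,\alpha-\gamma,\alpha-\beta,\alpha}(\lambda_{1}(r-s)^{\alpha},\lambda_{2}(r-s)^{\alpha-\gamma},\lambda_{3}(r-s)^{\alpha-\beta})\,g(s)\,ds.$$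
   Context: For real $a_1,a_2,a_3>0$ and $\delta\in\mathbb{R}$, the trivariate Mittag-Leffler function (with upper parameter $\eta=1$ omitted from the notation) is $$E_{a_1,a_2,a_3,\delta}(u,v,w)=\sum_{l=0}^{\infty}\sum_{p=0}^{\infty}\sum_{k=0}^{\infty}\frac{(l+p+k)!}{l!\,p!\,k!}\frac{u^l v^p w^k}{\Gamma(la_1+pa_2+ka_3+\delta)},$$ where $1/\Gamma$ is zero at the poles of $\Gamma$. For $0<\rho<1$ the Caputo fractional derivative is $({}^{C}D^{\rho}_{0^+}y)(r)=\frac{1}{\Gamma(1-\rho)}\int_0^r (r-s)^{-\rho}y'(s)\,ds$, $r>0$; for $\rho=1$ it is the ordinary derivative $y'(r)$. *)

theory Defs
  imports "HOL-Analysis.Analysis"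
begin

(* rGamma is the reciprocal Gamma function, with value 0 at the poles of Gamma. *)
definition mittag_leffler3 :: "real \<Rightarrow> real \<Rightarrow> real \<Rightarrow> real \<Rightarrow> real \<Rightarrow> real \<Rightarrow> real \<Rightarrow> real" where
  "mittag_leffler3 a1 a2 a3 \<delta> u v w =
     (\<Sum>l. \<Sum>p. \<Sum>k. fact (l + p + k) / (fact l * fact p * fact k) * (u ^ l * v ^ p * w ^ k)
        * rGamma (real l * a1 + real p * a2 + real k * a3 + \<delta>))"

(* Used for 0 < \<rho> \<le> 1 and r > 0.  The values of the integrand at s = 0, where deriv is
   two-sided, and at s = r, where 0 powr (-\<rho>) = 0, do not affect the integral. *)
definition caputo :: "real \<Rightarrow> (real \<Rightarrow> real) \<Rightarrow> real \<Rightarrow> real" where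
  "caputo \<rho> y r =
     (if \<rho> = 1 then deriv y r
      else 1 / Gamma (1 - \<rho>) * integral {0..r} (\<lambda>s. (r - s) powr (- \<rho>) * deriv y s))"

(* C^1([0,\<infinity>)): one-sided derivative at 0.  The library's C1_differentiable_on takes two-sided
   derivatives, which would constrain y on the negative half-line. *)
definition C1_halfline :: "(real \<Rightarrow> real) \<Rightarrow> bool" where
  "C1_halfline y \<longleftrightarrow>
     (\<exists>y'. (\<forall>r\<ge>0. (y has_real_derivative y' r) (at r within {0..})) \<and> continuous_on {0..} y')"

end

(* Write J^mu for the Riemann-Liouville integral. Since y(0) = 0, the Caputo derivative of order rho
   is J^(1 - rho) y', so applying J^alpha to the equation and using the semigroup law
   J^mu J^nu = J^(mu + nu) gives
     y = lam1 J^alpha y + lam2 J^(alpha - gamma) y + lam3 J^(alpha - beta) y + J^alpha g.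
   Apply J^(l alpha + p (alpha - gamma) + k (alpha - beta)) to y minus the first three terms on the
   right, multiply by (l + p + k)! / (l! p! k!) lam1^l lam2^p lam3^k and sum over l, p, k: by the
   Pascal recurrence of the trinomial coefficients everything cancels except y, so y is the
   corresponding series of integrals of g. Interchanging sum and integral produces the
   Mittag-Leffler kernel. All series converge absolutely because
   1 / Gamma(x) = O(T^(-x)) for every T > 0. *)
theory Submission
  imports Defs
begin

section \<open>Riemann-Liouville integrals\<close>

text \<open>The Riemann-Liouville kernel, cut off at \<open>t \<le> 0\<close> so that integration
  over the whole line sees only \<open>s < r\<close>.\<close>

definition frac_kernel :: "real \<Rightarrow> real \<Rightarrow> real" where
  "frac_kernel \<mu> t = (if t > 0 then t powr (\<mu> - 1) / Gamma \<mu> else 0)"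

lemma frac_kernel_measurable [measurable]: "frac_kernel \<mu> \<in> borel_measurable borel"
  unfolding frac_kernel_def by measurable

lemma frac_kernel_nonneg: "\<mu> > 0 \<Longrightarrow> frac_kernel \<mu> t \<ge> 0"
  by (simp add: frac_kernel_def Gamma_real_pos less_imp_le)

lemma frac_kernel_nonpos [simp]: "t \<le> 0 \<Longrightarrow> frac_kernel \<mu> t = 0"
  by (simp add: frac_kernel_def)

text \<open>The substitution s = t + c x with c = r - t leads to a multiple of the Beta integral,
  and Beta(\<nu>, \<mu>) = Gamma(\<mu>) Gamma(\<nu>) / Gamma(\<mu> + \<nu>). The form
  \<open>has_bochner_integral\<close> also supplies the integrability that Fubini requires
  later.\<close>

lemma frac_kernel_convolution:
  assumes "\<mu> > 0" "\<nu> > 0"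
  shows "has_bochner_integral lborel (\<lambda>s. frac_kernel \<mu> (r - s) * frac_kernel \<nu> (s - t))
           (frac_kernel (\<mu> + \<nu>) (r - t))"
proof (cases "t < r")
  case False
  then have "(\<lambda>s. frac_kernel \<mu> (r - s) * frac_kernel \<nu> (s - t)) = (\<lambda>s. 0)"
    by (auto simp: frac_kernel_def fun_eq_iff)
  with False show ?thesis by (simp add: has_bochner_integral_zero)
next
  case True
  define c where "c = r - t"
  have c: "c > 0" using True by (simp add: c_def)
  define B where "B = (\<lambda>x::real. indicator {0..1} x *\<^sub>R (x powr (\<nu> - 1) * (1 - x) powr (\<mu> - 1)))"
  \<comment> \<open>The exponent collects the powers of c from the two kernels; one further factor c
    comes from ds = c dx.\<close>
  define C where "C = c powr (\<mu> + \<nu> - 2) / (Gamma \<mu> * Gamma \<nu>)"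
  have "has_bochner_integral lborel B (Beta \<nu> \<mu>)"
    using integrable_Beta[of \<nu> \<mu>] set_borel_integral_eq_integral[OF integrable_Beta[of \<nu> \<mu>]]
      has_integral_Beta_real[of \<nu> \<mu>] assms
    by (simp add: has_bochner_integral_iff B_def set_integrable_def set_lebesgue_integral_def
        integral_unique)
  from has_bochner_integral_mult_right[OF this, of C]
  have 1: "has_bochner_integral lborel (\<lambda>x. C * B x) (C * Beta \<nu> \<mu>)" by simp
  have "(\<lambda>x. C * B x) = (\<lambda>x. frac_kernel \<mu> (r - (t + c * x)) * frac_kernel \<nu> (t + c * x - t))"
  proof
    fix x :: real
    have e: "r - (t + c * x) = c * (1 - x)" by (simp add: c_def algebra_simps)
    show "C * B x = frac_kernel \<mu> (r - (t + c * x)) * frac_kernel \<nu> (t + c * x - t)"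
    proof (cases "0 < x \<and> x < 1")
      case True
      then have "c * x > 0" "c * (1 - x) > 0" using c by auto
      moreover have "c powr (\<mu> + \<nu> - 2) = c powr (\<mu> - 1) * c powr (\<nu> - 1)"
        by (simp flip: powr_add)
      ultimately show ?thesis using True c
        unfolding e by (simp add: frac_kernel_def B_def C_def powr_mult)
    next
      case False
      then have "c * x \<le> 0 \<or> c * (1 - x) \<le> 0" using c by (auto simp: mult_le_0_iff)
      \<comment> \<open>This covers x = 0 and x = 1, where one factor has the form
        \<open>0 powr z\<close>, which is 0 by convention.\<close>
      moreover have "B x = 0" using False by (auto simp: B_def indicator_def)
      ultimately show ?thesis unfolding e by auto
    qed
  qed
  moreover have "C * Beta \<nu> \<mu> = frac_kernel (\<mu> + \<nu>) (r - t) /\<^sub>R \<bar>c\<bar>"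
  proof -
    have "Gamma \<mu> > 0" "Gamma \<nu> > 0" using assms by (auto intro: Gamma_real_pos)
    moreover have "c powr (\<mu> + \<nu> - 1) = c powr (\<mu> + \<nu> - 2) * c"
      using c powr_add[of c "\<mu> + \<nu> - 2" 1] by simp
    ultimately show ?thesis using c
      by (simp add: C_def Beta_def frac_kernel_def c_def[symmetric] field_simps)
  qed
  ultimately show ?thesis
    using 1 lborel_has_bochner_integral_real_affine_iff[of c
        "\<lambda>s. frac_kernel \<mu> (r - s) * frac_kernel \<nu> (s - t)" _ t] c by simp
qed

text \<open>Order 0 is set apart as the identity, since its kernel would be a delta distribution. It
  occurs as 1 - \<alpha> for \<alpha> = 1 and as the term l = p = k = 0 of the series.\<close>

definition frac_integral :: "real \<Rightarrow> (real \<Rightarrow> real) \<Rightarrow> real \<Rightarrow> real" where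
  "frac_integral \<mu> f r = (if \<mu> = 0 then f r else LINT s|lborel. frac_kernel \<mu> (r - s) * f s)"

section \<open>Causal functions: existence, bounds and the semigroup law\<close>

text \<open>Functions on the half-line are extended by 0 to the negative axis, which turns Riemann-Liouville
  integrals into convolutions over the whole line.\<close>

definition causal :: "(real \<Rightarrow> real) \<Rightarrow> bool" where
  "causal f \<longleftrightarrow> f \<in> borel_measurable borel \<and> (\<forall>x<0. f x = 0) \<and> (\<forall>R. \<exists>M. \<forall>x\<le>R. \<bar>f x\<bar> \<le> M)"

lemma causal_measurable: "causal f \<Longrightarrow> f \<in> borel_measurable borel"
  by (simp add: causal_def)

lemma causal_boundE:
  assumes "causal f" obtains M where "M \<ge> 0" "\<And>x. x \<le> R \<Longrightarrow> \<bar>f x\<bar> \<le> M"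
  using assms unfolding causal_def by (metis abs_ge_zero order_trans order_refl)

text \<open>\<open>frac_kernel 1\<close> is the Heaviside function, so M times it dominates |f|
  almost everywhere up to r. The convolution rule with \<nu> = 1 then gives both integrability and
  the value of the bound.\<close>

lemma
  assumes f: "causal f" and \<mu>: "\<mu> > 0"
  shows frac_kernel_integrable: "integrable lborel (\<lambda>s. frac_kernel \<mu> (r - s) * f s)"
    and frac_integral_norm_bound: "(\<And>x. x \<le> r \<Longrightarrow> \<bar>f x\<bar> \<le> M) \<Longrightarrow>
      (LINT s|lborel. \<bar>frac_kernel \<mu> (r - s) * f s\<bar>) \<le> M * frac_kernel (\<mu> + 1) r"
proof -
  have [measurable]: "f \<in> borel_measurable borel" using f by (rule causal_measurable)
  have hb: "has_bochner_integral lborel (\<lambda>s. K * (frac_kernel \<mu> (r - s) * frac_kernel 1 s))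
      (K * frac_kernel (\<mu> + 1) r)" for K
    using has_bochner_integral_mult_right[OF frac_kernel_convolution[OF \<mu>, of 1 r 0]] by simp
  \<comment> \<open>The point s = 0 is left out: \<open>frac_kernel 1 0\<close> is 0, while
    \<open>f 0\<close> may be nonzero.\<close>
  have bd: "AE s in lborel. norm (frac_kernel \<mu> (r - s) * f s)
      \<le> K * (frac_kernel \<mu> (r - s) * frac_kernel 1 s)" if "\<And>x. x \<le> r \<Longrightarrow> \<bar>f x\<bar> \<le> K" for K
    using AE_lborel_singleton[of 0]
  proof eventually_elim
    case (elim s)
    have n: "frac_kernel \<mu> (r - s) \<ge> 0" using \<mu> by (rule frac_kernel_nonneg)
    consider "s < 0" | "s \<ge> r" | "s > 0" "s < r" using elim by linarith
    then show ?case
    proof cases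
      case 1 with f show ?thesis by (simp add: causal_def)
    next
      case 2 then show ?thesis by simp
    next
      case 3
      have "norm (frac_kernel \<mu> (r - s) * f s) = frac_kernel \<mu> (r - s) * \<bar>f s\<bar>"
        using n by (simp add: abs_mult)
      also have "\<dots> \<le> frac_kernel \<mu> (r - s) * K" using 3 n that[of s] by (intro mult_left_mono) simp_all
      also have "\<dots> = K * (frac_kernel \<mu> (r - s) * frac_kernel 1 s)"
        using 3 by (simp add: frac_kernel_def)
      finally show ?thesis .
    qed
  qed
  obtain K where K: "\<And>x. x \<le> r \<Longrightarrow> \<bar>f x\<bar> \<le> K" using causal_boundE[OF f] by metis
  show int: "integrable lborel (\<lambda>s. frac_kernel \<mu> (r - s) * f s)"
  proof (rule Bochner_Integration.integrable_bound)
    show "integrable lborel (\<lambda>s. K * (frac_kernel \<mu> (r - s) * frac_kernel 1 s))"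
      using hb[of K] by (rule has_bochner_integral_iff[THEN iffD1, THEN conjunct1])
    show "AE s in lborel. norm (frac_kernel \<mu> (r - s) * f s)
        \<le> norm (K * (frac_kernel \<mu> (r - s) * frac_kernel 1 s))"
      using bd[OF K] by (rule eventually_mono) (simp_all add: order_trans[OF _ abs_ge_self])
  qed simp
  show "(LINT s|lborel. \<bar>frac_kernel \<mu> (r - s) * f s\<bar>) \<le> M * frac_kernel (\<mu> + 1) r"
    if "\<And>x. x \<le> r \<Longrightarrow> \<bar>f x\<bar> \<le> M"
    using integral_mono_AE[OF integrable_norm[OF int] _ bd[OF that]] hb[of M]
    by (auto simp: has_bochner_integral_iff)
qed

text \<open>For \<open>\<mu> = 0\<close> the right-hand side is just M, because
  \<open>frac_kernel 1 r\<close> is 1 for r > 0. Thus one estimate serves every term of the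
  series.\<close>

lemma frac_integral_bound:
  assumes f: "causal f" and \<mu>: "\<mu> \<ge> 0" and M: "\<And>x. x \<le> r \<Longrightarrow> \<bar>f x\<bar> \<le> M" and r: "r > 0"
  shows "\<bar>frac_integral \<mu> f r\<bar> \<le> M * frac_kernel (\<mu> + 1) r"
proof (cases "\<mu> = 0")
  case True
  then show ?thesis using r M[of r] by (simp add: frac_integral_def frac_kernel_def)
next
  case False
  then have "\<mu> > 0" using \<mu> by simp
  have "\<bar>LINT s|lborel. frac_kernel \<mu> (r - s) * f s\<bar> \<le> M * frac_kernel (\<mu> + 1) r"
    by (rule order_trans[OF integral_abs_bound frac_integral_norm_bound[OF f \<open>\<mu> > 0\<close> M]])
  with False show ?thesis by (simp add: frac_integral_def)
qed

text \<open>Fubini for the integrand \<open>F\<close>: integrating over s first merges the two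
  kernels into the kernel of order \<mu> + \<nu>, integrating over t first gives the iterated
  integral. Integrability of the outer integrand is a by-product.\<close>

lemma
  assumes f: "causal f" and \<mu>: "\<mu> > 0" and \<nu>: "\<nu> \<ge> 0"
  shows frac_integral_integrable: "integrable lborel (\<lambda>s. frac_kernel \<mu> (r - s) * frac_integral \<nu> f s)"
    and frac_integral_semigroup_pos: "frac_integral \<mu> (frac_integral \<nu> f) r = frac_integral (\<mu> + \<nu>) f r"
proof -
  have [measurable]: "f \<in> borel_measurable borel" using f by (rule causal_measurable)
  define F where "F = (\<lambda>t s. frac_kernel \<mu> (r - s) * frac_kernel \<nu> (s - t) * f t)"
  have "integrable lborel (\<lambda>s. frac_kernel \<mu> (r - s) * frac_integral \<nu> f s) \<and>
    frac_integral \<mu> (frac_integral \<nu> f) r = frac_integral (\<mu> + \<nu>) f r"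
  proof (cases "\<nu> = 0")
    case True
    then show ?thesis using frac_kernel_integrable[OF f \<mu>] by (simp add: frac_integral_def)
  next
    case False
    with \<nu> have \<nu>: "\<nu> > 0" by simp
    have F: "has_bochner_integral lborel (F t) (frac_kernel (\<mu> + \<nu>) (r - t) * f t)" for t
      unfolding F_def by (intro has_bochner_integral_mult_left frac_kernel_convolution \<mu> \<nu>)
    \<comment> \<open>The kernels are nonnegative, so the absolute value falls on f alone and the
      convolution rule applies once more; this is the absolute integrability behind Fubini.\<close>
    have Fabs: "has_bochner_integral lborel (\<lambda>s. \<bar>F t s\<bar>) \<bar>frac_kernel (\<mu> + \<nu>) (r - t) * f t\<bar>" for t
    proof -
      have "(\<lambda>s. \<bar>F t s\<bar>) = (\<lambda>s. frac_kernel \<mu> (r - s) * frac_kernel \<nu> (s - t) * \<bar>f t\<bar>)"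
        using frac_kernel_nonneg[OF \<mu>] frac_kernel_nonneg[OF \<nu>] by (simp add: F_def abs_mult)
      moreover have "\<bar>frac_kernel (\<mu> + \<nu>) (r - t) * f t\<bar> = frac_kernel (\<mu> + \<nu>) (r - t) * \<bar>f t\<bar>"
        using frac_kernel_nonneg[of "\<mu> + \<nu>" "r - t"] \<mu> \<nu> by (simp add: abs_mult)
      ultimately show ?thesis
        by (simp only:) (intro has_bochner_integral_mult_left frac_kernel_convolution \<mu> \<nu>)
    qed
    have int: "integrable (lborel \<Otimes>\<^sub>M lborel) (case_prod F)"
    proof (rule lborel_pair.Fubini_integrable)
      show "case_prod F \<in> borel_measurable (lborel \<Otimes>\<^sub>M lborel)"
        unfolding F_def by measurable
      show "integrable lborel (\<lambda>t. LINT s|lborel. norm (case_prod F (t, s)))"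
        using frac_kernel_integrable[OF f, of "\<mu> + \<nu>"] \<mu> \<nu>
        by (simp add: has_bochner_integral_integral_eq[OF Fabs])
      show "AE t in lborel. integrable lborel (\<lambda>s. case_prod F (t, s))"
        using F by (auto simp: has_bochner_integral_iff)
    qed
    have eq: "(LINT t|lborel. F t s) = frac_kernel \<mu> (r - s) * frac_integral \<nu> f s" for s
      using \<nu> by (simp add: F_def frac_integral_def mult.assoc)
    have "(LINT s|lborel. LINT t|lborel. F t s) = (LINT t|lborel. LINT s|lborel. F t s)"
      by (rule lborel_pair.Fubini_integral[OF int])
    then show ?thesis using lborel_pair.integrable_snd[OF int] \<mu> \<nu> F
      by (simp add: eq has_bochner_integral_iff frac_integral_def)
  qed
  then show "integrable lborel (\<lambda>s. frac_kernel \<mu> (r - s) * frac_integral \<nu> f s)"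
    and "frac_integral \<mu> (frac_integral \<nu> f) r = frac_integral (\<mu> + \<nu>) f r" by auto
qed

lemma frac_integral_semigroup:
  assumes "causal f" "\<mu> \<ge> 0" "\<nu> \<ge> 0"
  shows "frac_integral \<mu> (frac_integral \<nu> f) r = frac_integral (\<mu> + \<nu>) f r"
  using frac_integral_semigroup_pos[of f \<mu> \<nu> r] assms
  by (cases "\<mu> = 0") (auto simp: frac_integral_def[of 0])

section \<open>Extension by zero, antiderivatives and Caputo derivatives\<close>

lemma causal_extend:
  assumes "continuous_on {0..} f"
  shows "causal (\<lambda>x. if x \<ge> 0 then f x else 0)"
proof -
  have "(\<lambda>x. if x \<in> {0..} then f x else 0) \<in> borel_measurable borel"
    by (intro borel_measurable_continuous_on_if assms) auto
  moreover have "\<exists>M. \<forall>x\<le>R. \<bar>if x \<ge> 0 then f x else 0\<bar> \<le> M" for R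
  proof -
    have "compact (f ` {0..R})"
      using assms by (intro compact_continuous_image continuous_on_subset[OF assms]) auto
    then obtain M where "\<forall>z\<in>f ` {0..R}. norm z \<le> M"
      using compact_imp_bounded bounded_iff by metis
    then have "\<forall>x\<le>R. \<bar>if x \<ge> 0 then f x else 0\<bar> \<le> max M 0" by (auto intro: max.coboundedI1)
    then show ?thesis ..
  qed
  ultimately show ?thesis by (simp add: causal_def)
qed

lemma frac_integral_neg: "causal f \<Longrightarrow> r < 0 \<Longrightarrow> frac_integral \<mu> f r = 0"
proof -
  assume f: "causal f" and r: "r < 0"
  have "(\<lambda>s. frac_kernel \<mu> (r - s) * f s) = (\<lambda>s. 0)"
  proof
    fix s show "frac_kernel \<mu> (r - s) * f s = 0"
      using f r by (cases "s < 0") (auto simp: causal_def)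
  qed
  then show ?thesis using f r by (simp add: frac_integral_def causal_def)
qed

text \<open>Passes from the Lebesgue convolution to the gauge integral over [0, r], in which Caputo
  derivatives and the final formula are expressed.\<close>

lemma frac_integral_has_integral:
  assumes f: "causal f" and \<mu>: "\<mu> > 0"
  shows "((\<lambda>s. (r - s) powr (\<mu> - 1) / Gamma \<mu> * f s) has_integral frac_integral \<mu> f r) {0..r}"
proof -
  have "((\<lambda>s. frac_kernel \<mu> (r - s) * f s) has_integral frac_integral \<mu> f r) UNIV"
    using has_integral_integral_real[OF frac_kernel_integrable[OF f \<mu>, of r]] \<mu>
    by (simp add: frac_integral_def)
  \<comment> \<open>The functions agree even at s = r, where \<open>0 powr (\<mu> - 1)\<close> is 0,
    like the kernel.\<close>
  also have "(\<lambda>s. frac_kernel \<mu> (r - s) * f s) =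
      (\<lambda>s. if s \<in> {0..r} then (r - s) powr (\<mu> - 1) / Gamma \<mu> * f s else 0)"
    using f by (auto simp: frac_kernel_def causal_def fun_eq_iff)
  finally show ?thesis by (simp only: has_integral_restrict_UNIV)
qed

text \<open>The fundamental theorem of calculus read as J^1 y' = y; the initial condition removes
  the boundary term.\<close>

lemma frac_integral_1_antiderivative:
  assumes y: "\<And>r. r \<ge> 0 \<Longrightarrow> (y has_real_derivative v r) (at r within {0..})"
    and v: "continuous_on {0..} v" and y0: "y 0 = 0"
  shows "frac_integral 1 (\<lambda>x. if x \<ge> 0 then v x else 0) r = (if r \<ge> 0 then y r else 0)"
proof (cases "r \<ge> 0")
  case False
  then show ?thesis using frac_integral_neg[OF causal_extend[OF v]] by simp
next
  case True
  have "(v has_integral y r - y 0) {0..r}"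
    using True DERIV_subset[OF y]
    by (intro fundamental_theorem_of_calculus) (auto simp flip: has_real_derivative_iff_has_vector_derivative)
  moreover have "((\<lambda>s. (r - s) powr (1 - 1) / Gamma 1 * (if s \<ge> 0 then v s else 0)) has_integral
      frac_integral 1 (\<lambda>x. if x \<ge> 0 then v x else 0) r) {0..r}"
    by (rule frac_integral_has_integral[OF causal_extend[OF v]]) simp
  \<comment> \<open>The kernel factor \<open>(r - s) powr 0\<close> is 1 except at s = r, where it
    is 0; that point is negligible.\<close>
  then have "(v has_integral frac_integral 1 (\<lambda>x. if x \<ge> 0 then v x else 0) r) {0..r}"
    by (rule has_integral_spike[of "{r}", rotated 2]) auto
  ultimately show ?thesis using True y0 by (auto dest: has_integral_unique)
qed

text \<open>For s > 0 the one-sided derivative \<open>v\<close> is the two-sided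
  \<open>deriv y\<close>, so the integrands can differ only at s = 0. Order \<rho> = 1 matches
  because the integral of order 0 is the identity.\<close>

lemma caputo_eq_frac_integral:
  assumes y: "\<And>r. r \<ge> 0 \<Longrightarrow> (y has_real_derivative v r) (at r within {0..})"
    and v: "continuous_on {0..} v" and \<rho>: "\<rho> \<le> 1" and r: "r > 0"
  shows "caputo \<rho> y r = frac_integral (1 - \<rho>) (\<lambda>x. if x \<ge> 0 then v x else 0) r"
proof -
  have deriv: "deriv y s = v s" if "s > 0" for s
  proof (rule DERIV_imp_deriv)
    have "at s within {0..} = at s" using that by (intro at_within_interior) simp
    then show "(y has_real_derivative v s) (at s)" using y[of s] that by simp
  qed
  show ?thesis
  proof (cases "\<rho> = 1")
    case True
    then show ?thesis using r deriv by (simp add: caputo_def frac_integral_def)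
  next
    case False
    with \<rho> have "1 - \<rho> > 0" by simp
    from frac_integral_has_integral[OF causal_extend[OF v] this, of r]
    have "((\<lambda>s. 1 / Gamma (1 - \<rho>) * ((r - s) powr (- \<rho>) * deriv y s)) has_integral
        frac_integral (1 - \<rho>) (\<lambda>x. if x \<ge> 0 then v x else 0) r) {0..r}"
      by (rule has_integral_spike[of "{0}", rotated 2]) (auto simp: deriv)
    from integral_unique[OF this] show ?thesis using False by (simp add: caputo_def)
  qed
qed

section \<open>Convergence of the Mittag-Leffler series\<close>

text \<open>Obtained by restricting the integral defining the Gamma function to \<open>[T, T + 1]\<close>.\<close>

lemma inverse_Gamma_le:
  fixes x T :: real
  assumes x: "x > 0" and T: "T > 0"
  shows "inverse (Gamma x) \<le> (T + 1) * exp (T + 1) * T powr (- x)"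
proof -
  \<comment> \<open>A lower bound of the integrand on [T, T + 1]: reading
    \<open>t powr (x - 1)\<close> as \<open>t powr x / t\<close> makes each factor monotone,
    whatever the sign of x - 1.\<close>
  define K where "K = T powr x / (T + 1) / exp (T + 1)"
  have K: "K > 0" using T by (simp add: K_def)
  have "((\<lambda>t. t powr (x - 1) / exp t) has_integral integral {T..T+1} (\<lambda>t. t powr (x - 1) / exp t)) {T..T+1}"
    using T by (intro integrable_integral integrable_continuous_real continuous_intros) auto
  then have "integral {T..T+1} (\<lambda>t. t powr (x - 1) / exp t) \<le> Gamma x"
    using T by (intro has_integral_subset_le[OF _ _ Gamma_integral_real[OF x]]) auto
  moreover have "integral {T..T+1} (\<lambda>t. K) \<le> integral {T..T+1} (\<lambda>t. t powr (x - 1) / exp t)"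
  proof (rule integral_le)
    show "(\<lambda>t. t powr (x - 1) / exp t) integrable_on {T..T+1}"
      using T by (intro integrable_continuous_real continuous_intros) auto
    show "K \<le> t powr (x - 1) / exp t" if "t \<in> {T..T+1}" for t
    proof -
      have "T powr x / (T + 1) / exp (T + 1) \<le> t powr x / t / exp t"
        using that T x by (intro frac_le powr_mono2) auto
      then show ?thesis using that T by (simp add: K_def powr_diff)
    qed
  qed auto
  ultimately have "K \<le> Gamma x" by simp
  then have "inverse (Gamma x) \<le> inverse K" using K by (simp add: le_imp_inverse_le)
  also have "inverse K = (T + 1) * exp (T + 1) * T powr (- x)"
    by (simp add: K_def powr_minus field_simps)
  finally show ?thesis .
qed

section \<open>Trinomial coefficients and absolute convergence over triples\<close>

definition trinomial :: "nat \<Rightarrow> nat \<Rightarrow> nat \<Rightarrow> real" where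
  "trinomial l p k = fact (l + p + k) / (fact l * fact p * fact k)"

lemma trinomial_nonneg: "trinomial l p k \<ge> 0"
  by (simp add: trinomial_def)

text \<open>A product of two binomial coefficients, each at most a power of 2. Any geometric bound
  would do, because T in \<open>inverse_Gamma_le\<close> can be taken as large as required.\<close>

lemma trinomial_le: "trinomial l p k \<le> 4 ^ (l + p + k)"
proof -
  have "trinomial l p k = real ((l + p + k) choose l) * real ((p + k) choose p)"
    by (simp add: trinomial_def binomial_fact add.assoc)
  also have "\<dots> \<le> 2 ^ (l + p + k) * 2 ^ (p + k)"
    using of_nat_mono[OF binomial_le_pow2[of "l + p + k" l], where 'a = real]
      of_nat_mono[OF binomial_le_pow2[of "p + k" p], where 'a = real]
    by (intro mult_mono) simp_all
  also have "\<dots> \<le> 2 ^ (l + p + k) * 2 ^ (l + p + k)"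
    by (intro mult_left_mono power_increasing) auto
  also have "\<dots> = (4::real) ^ (l + p + k)" by (simp flip: power_mult_distrib)
  finally show ?thesis .
qed

text \<open>The majorant for the Mittag-Leffler series, built by multiplying nonnegative summable
  families twice.\<close>

lemma geometric3_summable:
  "(\<lambda>(l, p, k). (1/2) ^ l * ((1/2) ^ p * (1/2) ^ k) :: real) summable_on UNIV"
proof -
  have g: "(\<lambda>n. (1/2::real) ^ n) summable_on UNIV"
    by (intro norm_summable_imp_summable_on) (simp add: summable_geometric)
  have t: "(\<lambda>(x, y). f x * h y :: real) summable_on UNIV"
    if "f summable_on UNIV" "h summable_on UNIV" "\<And>x. f x \<ge> 0" "\<And>y. h y \<ge> 0"
    for f :: "'a \<Rightarrow> real" and h :: "'b \<Rightarrow> real"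
  proof -
    have "(\<lambda>z. norm (case z of (x, y) \<Rightarrow> f x * h y)) summable_on UNIV \<times> UNIV"
      using that by (subst Infinite_Sum.abs_summable_on_Sigma_iff)
        (auto simp: abs_mult infsum_cmult_right' infsum_nonneg
          intro!: summable_on_cmult_right summable_on_cmult_left)
    then show ?thesis using abs_summable_summable by fastforce
  qed
  have "(\<lambda>(p, k). (1/2) ^ p * (1/2) ^ k :: real) summable_on (UNIV :: (nat \<times> nat) set)"
    by (intro t g) auto
  from t[OF g this] show ?thesis by (simp add: case_prod_unfold)
qed

text \<open>The bounds for the trinomial coefficient and for 1 / Gamma both factor over the three
  indices, so each index contributes a geometric sequence; a large T makes all three ratios at most
  1/2.\<close>

lemma mittag_leffler3_summable:
  fixes u v w :: real
  assumes a: "a1 > 0" "a2 > 0" "a3 > 0" and \<delta>: "\<delta> > 0"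
  shows "(\<lambda>(l, p, k). \<bar>trinomial l p k * (u ^ l * v ^ p * w ^ k) *
      rGamma (real l * a1 + real p * a2 + real k * a3 + \<delta>)\<bar>) summable_on UNIV"
proof -
  have ev: "\<forall>\<^sub>F T in at_top. 4 * \<bar>z\<bar> * T powr (- b) \<le> 1 / 2" if "b > 0" for z b :: real
  proof -
    have "((\<lambda>T. 4 * \<bar>z\<bar> * T powr (- b)) \<longlongrightarrow> 4 * \<bar>z\<bar> * 0) at_top"
      using that by (intro tendsto_mult tendsto_const tendsto_neg_powr filterlim_ident) auto
    then have "\<forall>\<^sub>F T in at_top. 4 * \<bar>z\<bar> * T powr (- b) < 1 / 2"
      by (rule order_tendstoD) simp
    then show ?thesis by (rule eventually_mono) simp
  qed
  have "\<forall>\<^sub>F T::real in at_top. T > 0 \<and> 4 * \<bar>u\<bar> * T powr (- a1) \<le> 1 / 2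
      \<and> 4 * \<bar>v\<bar> * T powr (- a2) \<le> 1 / 2 \<and> 4 * \<bar>w\<bar> * T powr (- a3) \<le> 1 / 2"
    using a by (intro eventually_conj ev eventually_gt_at_top)
  then obtain T where T: "T > 0" "4 * \<bar>u\<bar> * T powr (- a1) \<le> 1 / 2"
      "4 * \<bar>v\<bar> * T powr (- a2) \<le> 1 / 2" "4 * \<bar>w\<bar> * T powr (- a3) \<le> 1 / 2"
    unfolding eventually_at_top_linorder by blast
  define C where "C = (T + 1) * exp (T + 1) * T powr (- \<delta>)"
  have C: "C \<ge> 0" using T by (simp add: C_def)
  have bd: "\<bar>trinomial l p k * (u ^ l * v ^ p * w ^ k) *
      rGamma (real l * a1 + real p * a2 + real k * a3 + \<delta>)\<bar> \<le> C * ((1/2) ^ l * ((1/2) ^ p * (1/2) ^ k))"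
    for l p k
  proof -
    define x where "x = real l * a1 + real p * a2 + real k * a3 + \<delta>"
    have x: "x > 0" unfolding x_def using a \<delta> by (intro add_nonneg_pos add_nonneg_nonneg) auto
    have pw: "T powr (- (real n * b)) = (T powr (- b)) ^ n" for n b
      using T by (simp add: powr_powr mult.commute flip: powr_realpow)
    have "\<bar>trinomial l p k * (u ^ l * v ^ p * w ^ k) * rGamma x\<bar>
        = trinomial l p k * (\<bar>u\<bar> ^ l * \<bar>v\<bar> ^ p * \<bar>w\<bar> ^ k) * inverse (Gamma x)"
      using trinomial_nonneg[of l p k] Gamma_real_pos[OF x]
      by (simp add: abs_mult power_abs rGamma_inverse_Gamma)
    also have "\<dots> \<le> 4 ^ (l + p + k) * (\<bar>u\<bar> ^ l * \<bar>v\<bar> ^ p * \<bar>w\<bar> ^ k) *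
        ((T + 1) * exp (T + 1) * T powr (- x))"
      using trinomial_le[of l p k] inverse_Gamma_le[OF x T(1)] Gamma_real_pos[OF x]
      by (intro mult_mono) auto
    also have "T powr (- x) = T powr (- \<delta>) *
        ((T powr (- a1)) ^ l * (T powr (- a2)) ^ p * (T powr (- a3)) ^ k)"
      unfolding pw[symmetric] by (simp add: x_def flip: powr_add)
    also have "4 ^ (l + p + k) * (\<bar>u\<bar> ^ l * \<bar>v\<bar> ^ p * \<bar>w\<bar> ^ k) * ((T + 1) * exp (T + 1) * \<dots>)
        = C * ((4 * \<bar>u\<bar> * T powr (- a1)) ^ l * ((4 * \<bar>v\<bar> * T powr (- a2)) ^ p
          * (4 * \<bar>w\<bar> * T powr (- a3)) ^ k))"
      by (simp add: C_def power_add power_mult_distrib)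
    also have "\<dots> \<le> C * ((1/2) ^ l * ((1/2) ^ p * (1/2) ^ k))"
      using T C by (intro mult_left_mono mult_mono power_mono) auto
    finally show ?thesis unfolding x_def .
  qed
  show ?thesis
  proof (rule summable_on_comparison_test)
    show "(\<lambda>(l, p, k). C * ((1/2) ^ l * ((1/2) ^ p * (1/2) ^ k))) summable_on UNIV"
      using summable_on_cmult_right[OF geometric3_summable, of C] by (simp add: case_prod_unfold)
  qed (use bd in auto)
qed

text \<open>Absolute convergence identifies the iterated \<open>suminf\<close> of the definition
  with an unordered sum over triples, which may be reindexed and enumerated freely.\<close>

lemma has_sum_mittag_leffler3:
  fixes u v w :: real
  assumes a: "a1 > 0" "a2 > 0" "a3 > 0" and \<delta>: "\<delta> > 0"
  shows "((\<lambda>(l, p, k). trinomial l p k * (u ^ l * v ^ p * w ^ k) *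
      rGamma (real l * a1 + real p * a2 + real k * a3 + \<delta>)) has_sum
      mittag_leffler3 a1 a2 a3 \<delta> u v w) UNIV"
proof -
  define t where "t = (\<lambda>l p k. trinomial l p k * (u ^ l * v ^ p * w ^ k) *
      rGamma (real l * a1 + real p * a2 + real k * a3 + \<delta>))"
  have s: "(\<lambda>(l, p, k). t l p k) summable_on UNIV"
    by (rule abs_summable_summable)
      (use mittag_leffler3_summable[OF a \<delta>, of u v w] in \<open>simp add: t_def case_prod_unfold\<close>)
  have suminf: "infsum f UNIV = suminf f" if "f summable_on UNIV" for f :: "nat \<Rightarrow> real"
    using has_sum_imp_sums[OF has_sum_infsum[OF that]] by (simp add: sums_iff)
  have s1: "(\<lambda>(l, pk). case pk of (p, k) \<Rightarrow> t l p k) summable_on UNIV \<times> UNIV"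
    using s by simp
  have s2: "(\<lambda>(p, k). t l p k) summable_on UNIV \<times> UNIV" for l
    using summable_on_SigmaD1[OF s1, of l] by simp
  have s3: "(\<lambda>k. t l p k) summable_on UNIV" for l p
    using summable_on_SigmaD1[OF s2, of p] by simp
  have i2: "infsum (\<lambda>(p, k). t l p k) UNIV = (\<Sum>p. \<Sum>k. t l p k)" for l
    using infsum_Sigma'_banach[OF s2] suminf[OF summable_on_Sigma_banach[OF s2]] suminf[OF s3]
    by simp
  have "infsum (\<lambda>(l, p, k). t l p k) UNIV = (\<Sum>l. \<Sum>p. \<Sum>k. t l p k)"
    using infsum_Sigma'_banach[OF s1] suminf[OF summable_on_Sigma_banach[OF s1]] i2 by simp
  also have "\<dots> = mittag_leffler3 a1 a2 a3 \<delta> u v w"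
    by (simp add: mittag_leffler3_def t_def trinomial_def)
  finally show ?thesis using has_sum_infsum[OF s] by (simp add: t_def)
qed

section \<open>Inversion of the integral equation\<close>

text \<open>Each coefficient is the share i / n of the coefficient with one index raised, where i is
  the raised index and n the new total. The three shares of one coefficient add up to 1 for n > 0,
  which is Pascal's recurrence.\<close>

lemma trinomial_Suc:
  "trinomial l p k = real (Suc l) / real (Suc l + p + k) * trinomial (Suc l) p k"
  "trinomial l p k = real (Suc p) / real (l + Suc p + k) * trinomial l (Suc p) k"
  "trinomial l p k = real (Suc k) / real (l + p + Suc k) * trinomial l p (Suc k)"
proof -
  have eq: "A / (B * (C * D)) = x / y * ((y * A) / (x * B * (C * D)))"
    if "x > 0" "y > 0" for A B C D x y :: real
    using that by (simp add: divide_simps)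
  show "trinomial l p k = real (Suc l) / real (Suc l + p + k) * trinomial (Suc l) p k"
    unfolding trinomial_def using eq[of "real (Suc l)" "real (Suc (l + p + k))" "fact (l+p+k)" "fact l" "fact p" "fact k"]
    by (simp add: fact_Suc mult_ac)
  show "trinomial l p k = real (Suc p) / real (l + Suc p + k) * trinomial l (Suc p) k"
    unfolding trinomial_def using eq[of "real (Suc p)" "real (Suc (l + p + k))" "fact (l+p+k)" "fact p" "fact l" "fact k"]
    by (simp add: fact_Suc mult_ac)
  show "trinomial l p k = real (Suc k) / real (l + p + Suc k) * trinomial l p (Suc k)"
    unfolding trinomial_def using eq[of "real (Suc k)" "real (Suc (l + p + k))" "fact (l+p+k)" "fact k" "fact l" "fact p"]
    by (simp add: fact_Suc mult_ac)
qed

lemma has_sum_diff: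
  fixes f g :: "'a \<Rightarrow> real"
  assumes "(f has_sum a) A" "(g has_sum b) A"
  shows "((\<lambda>x. f x - g x) has_sum (a - b)) A"
  using has_sum_add[OF assms(1) has_sum_cmult_right[OF assms(2), of "-1"]] by simp

text \<open>Reindexing each shifted sum to the unshifted \<open>b\<close> leaves the coefficient
  times its share l / n, p / n or k / n. The shares add up to 1 everywhere except at the origin, so
  only \<open>b 0 0 0\<close> survives. Absolute summability permits the splitting into four
  sums.\<close>

lemma trinomial_telescope:
  fixes b :: "nat \<Rightarrow> nat \<Rightarrow> nat \<Rightarrow> real"
  assumes summable: "(\<lambda>(l, p, k). \<bar>trinomial l p k * b l p k\<bar>) summable_on UNIV"
  shows "((\<lambda>(l, p, k). trinomial l p k *
      (b l p k - b (Suc l) p k - b l (Suc p) k - b l p (Suc k))) has_sum b 0 0 0) UNIV"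
proof -
  define f where "f = (\<lambda>(l, p, k). trinomial l p k * b l p k)"
  \<comment> \<open>The share of \<open>f\<close> selected by a coordinate \<open>c\<close>; at the
    origin it is 0, since 0 / 0 = 0.\<close>
  define w where "w = (\<lambda>c (l, p, k). real (c (l, p, k) :: nat) / real (l + p + k) * f (l, p, k))"
  have "(\<lambda>x. \<bar>f x\<bar>) = (\<lambda>(l, p, k). \<bar>trinomial l p k * b l p k\<bar>)"
    by (auto simp: f_def fun_eq_iff)
  with summable have fabs: "(\<lambda>x. \<bar>f x\<bar>) summable_on UNIV"
    by simp
  have f: "f summable_on UNIV"
    by (rule abs_summable_summable) (use fabs in simp)
  have w_summable: "w c summable_on UNIV" if "\<And>l p k. c (l, p, k) \<le> l + p + k" for c
  proof (rule abs_summable_summable, rule summable_on_comparison_test[OF fabs])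
    fix x :: "nat \<times> nat \<times> nat"
    obtain l p k where x: "x = (l, p, k)" by (cases x)
    have "real (c x) / real (l + p + k) \<le> 1"
      using that[of l p k] by (auto simp: x divide_le_eq_1 simp del: of_nat_add)
    from mult_right_mono[OF this abs_ge_zero[of "f x"]] show "norm (w c x) \<le> \<bar>f x\<bar>"
      by (simp add: w_def x abs_mult del: of_nat_add)
  qed simp
  \<comment> \<open>Raising one index is an injection \<open>h\<close>; triples outside its range
    have that coordinate equal to 0, so \<open>w c\<close> vanishes there.\<close>
  have shift: "((\<lambda>(l, p, k). trinomial l p k * b' (l, p, k)) has_sum infsum (w c) UNIV) UNIV"
    if c: "\<And>l p k. c (l, p, k) \<le> l + p + k" and h: "inj h"
      and eq: "\<And>l p k. trinomial l p k * b' (l, p, k) = w c (h (l, p, k))"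
      and z: "\<And>x. x \<notin> range h \<Longrightarrow> c x = 0"
    for c h and b' :: "nat \<times> nat \<times> nat \<Rightarrow> real"
  proof -
    have "(w c has_sum infsum (w c) UNIV) UNIV"
      using w_summable[OF c] by (rule has_sum_infsum)
    also have "?this \<longleftrightarrow> (w c has_sum infsum (w c) UNIV) (range h)"
      by (rule has_sum_cong_neutral) (use z in \<open>auto simp: w_def split: prod.splits\<close>)
    also have "\<dots> \<longleftrightarrow> ((w c \<circ> h) has_sum infsum (w c) UNIV) UNIV"
      by (rule has_sum_reindex[OF h])
    also have "w c \<circ> h = (\<lambda>(l, p, k). trinomial l p k * b' (l, p, k))"
      by (auto simp: eq fun_eq_iff)
    finally show ?thesis .
  qed
  define c1 c2 c3 :: "nat \<times> nat \<times> nat \<Rightarrow> nat" where "c1 = (\<lambda>(l, p, k). l)"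
    and "c2 = (\<lambda>(l, p, k). p)" and "c3 = (\<lambda>(l, p, k). k)"
  note cs = c1_def c2_def c3_def
  have 1: "((\<lambda>(l, p, k). trinomial l p k * b (Suc l) p k) has_sum infsum (w c1) UNIV) UNIV"
  proof -
    have "((\<lambda>(l, p, k). trinomial l p k * (case (l, p, k) of (l, p, k) \<Rightarrow> b (Suc l) p k)) has_sum infsum (w c1) UNIV) UNIV"
    proof (rule shift[where h = "\<lambda>(l, p, k). (Suc l, p, k)"])
      show "trinomial l p k * (case (l, p, k) of (l, p, k) \<Rightarrow> b (Suc l) p k) =
          w c1 (case (l, p, k) of (l, p, k) \<Rightarrow> (Suc l, p, k))" for l p k
        by (subst trinomial_Suc(1)) (simp add: w_def c1_def f_def add_ac mult_ac)
      show "c1 x = 0" if "x \<notin> range (\<lambda>(l, p, k). (Suc l, p, k))" for x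
      proof (cases x)
        case (fields l p k)
        with that show ?thesis by (cases l) (auto simp: c1_def image_iff)
      qed
    qed (auto simp: c1_def inj_def)
    then show ?thesis by simp
  qed
  have 2: "((\<lambda>(l, p, k). trinomial l p k * b l (Suc p) k) has_sum infsum (w c2) UNIV) UNIV"
  proof -
    have "((\<lambda>(l, p, k). trinomial l p k * (case (l, p, k) of (l, p, k) \<Rightarrow> b l (Suc p) k)) has_sum infsum (w c2) UNIV) UNIV"
    proof (rule shift[where h = "\<lambda>(l, p, k). (l, Suc p, k)"])
      show "trinomial l p k * (case (l, p, k) of (l, p, k) \<Rightarrow> b l (Suc p) k) =
          w c2 (case (l, p, k) of (l, p, k) \<Rightarrow> (l, Suc p, k))" for l p k
        by (subst trinomial_Suc(2)) (simp add: w_def c2_def f_def add_ac mult_ac)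
      show "c2 x = 0" if "x \<notin> range (\<lambda>(l, p, k). (l, Suc p, k))" for x
      proof (cases x)
        case (fields l p k)
        with that show ?thesis by (cases p) (auto simp: c2_def image_iff)
      qed
    qed (auto simp: c2_def inj_def)
    then show ?thesis by simp
  qed
  have 3: "((\<lambda>(l, p, k). trinomial l p k * b l p (Suc k)) has_sum infsum (w c3) UNIV) UNIV"
  proof -
    have "((\<lambda>(l, p, k). trinomial l p k * (case (l, p, k) of (l, p, k) \<Rightarrow> b l p (Suc k))) has_sum infsum (w c3) UNIV) UNIV"
    proof (rule shift[where h = "\<lambda>(l, p, k). (l, p, Suc k)"])
      show "trinomial l p k * (case (l, p, k) of (l, p, k) \<Rightarrow> b l p (Suc k)) =
          w c3 (case (l, p, k) of (l, p, k) \<Rightarrow> (l, p, Suc k))" for l p k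
        by (subst trinomial_Suc(3)) (simp add: w_def c3_def f_def add_ac mult_ac)
      show "c3 x = 0" if "x \<notin> range (\<lambda>(l, p, k). (l, p, Suc k))" for x
      proof (cases x)
        case (fields l p k)
        with that show ?thesis by (cases k) (auto simp: c3_def image_iff)
      qed
    qed (auto simp: c3_def inj_def)
    then show ?thesis by simp
  qed
  have w_sum: "(w c has_sum infsum (w c) UNIV) UNIV" if "\<And>l p k. c (l, p, k) \<le> l + p + k" for c
    using w_summable[OF that] by (rule has_sum_infsum)
  have "((\<lambda>x. f x - w c1 x - w c2 x - w c3 x) has_sum
      infsum f UNIV - infsum (w c1) UNIV - infsum (w c2) UNIV - infsum (w c3) UNIV) UNIV"
    by (intro has_sum_diff w_sum has_sum_infsum f) (auto simp: cs)
  moreover have "((\<lambda>x. f x - w c1 x - w c2 x - w c3 x) has_sum b 0 0 0) UNIV"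
  proof -
    have "f (l, p, k) - w c1 (l, p, k) - w c2 (l, p, k) - w c3 (l, p, k) =
        (if (l, p, k) = (0, 0, 0) then b 0 0 0 else 0)" for l p k
    proof (cases "l + p + k = 0")
      case True
      then show ?thesis by (simp add: w_def cs f_def trinomial_def)
    next
      case False
      then have "real l + real p + real k \<noteq> 0" by (simp flip: of_nat_add)
      then have "f (l, p, k) = (real l + real p + real k) / real (l + p + k) * f (l, p, k)" by simp
      also have "\<dots> = w c1 (l, p, k) + w c2 (l, p, k) + w c3 (l, p, k)"
        by (simp only: w_def cs add_divide_distrib distrib_right prod.case)
      finally show ?thesis using False by auto
    qed
    then have "(\<lambda>x. f x - w c1 x - w c2 x - w c3 x) = (\<lambda>x. if x = (0, 0, 0) then b 0 0 0 else 0)"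
      by (auto simp: fun_eq_iff)
    moreover have "((\<lambda>x. if x = (0, 0, 0) then b 0 0 0 else 0) has_sum b 0 0 0) (UNIV :: (nat \<times> nat \<times> nat) set)"
      by (rule has_sum_finite_neutralI[of "{(0, 0, 0)}"]) auto
    ultimately show ?thesis by simp
  qed
  \<comment> \<open>Only this value is kept: the shifted sums have the same totals as the
    \<open>w\<close>, so it is also the total of the differences.\<close>
  ultimately have "infsum f UNIV - infsum (w c1) UNIV - infsum (w c2) UNIV - infsum (w c3) UNIV = b 0 0 0"
    by (rule has_sum_unique)
  moreover have "((\<lambda>x. f x - (case x of (l, p, k) \<Rightarrow> trinomial l p k * b (Suc l) p k)
      - (case x of (l, p, k) \<Rightarrow> trinomial l p k * b l (Suc p) k)
      - (case x of (l, p, k) \<Rightarrow> trinomial l p k * b l p (Suc k))) has_sum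
      infsum f UNIV - infsum (w c1) UNIV - infsum (w c2) UNIV - infsum (w c3) UNIV) UNIV"
    by (intro has_sum_diff 1 2 3 has_sum_infsum f)
  ultimately show ?thesis by (simp add: f_def case_prod_unfold right_diff_distrib)
qed

section \<open>Kernel series, the series solution and its integral form\<close>

text \<open>The powers of t inside a kernel split off into the three arguments, turning a weighted
  kernel into \<open>t powr (\<delta> - 1)\<close> times a Mittag-Leffler summand.\<close>

lemma frac_kernel_monomial:
  fixes l p k :: nat
  assumes t: "t > 0" and x: "x = real l * a1 + real p * a2 + real k * a3 + \<delta>"
  shows "c1 ^ l * c2 ^ p * c3 ^ k * frac_kernel x t =
    t powr (\<delta> - 1) * ((c1 * t powr a1) ^ l * (c2 * t powr a2) ^ p * (c3 * t powr a3) ^ k * rGamma x)"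
proof -
  have pw: "(t powr b) ^ n = t powr (real n * b)" for n b
    using t by (simp add: powr_powr mult.commute flip: powr_realpow)
  have "t powr (x - 1) = t powr (\<delta> - 1) * ((t powr a1) ^ l * (t powr a2) ^ p * (t powr a3) ^ k)"
    unfolding pw powr_add[symmetric] by (simp add: x algebra_simps)
  then show ?thesis using t
    by (simp add: frac_kernel_def rGamma_inverse_Gamma power_mult_distrib divide_inverse mult_ac)
qed

lemma frac_kernel_series:
  fixes c1 c2 c3 :: real
  assumes a: "a1 > 0" "a2 > 0" "a3 > 0" and \<delta>: "\<delta> > 0"
  shows "(\<lambda>(l, p, k). \<bar>trinomial l p k * (c1 ^ l * c2 ^ p * c3 ^ k *
      frac_kernel (real l * a1 + real p * a2 + real k * a3 + \<delta>) t)\<bar>) summable_on UNIV" (is ?abs)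
    and "t > 0 \<Longrightarrow> ((\<lambda>(l, p, k). trinomial l p k * (c1 ^ l * c2 ^ p * c3 ^ k *
      frac_kernel (real l * a1 + real p * a2 + real k * a3 + \<delta>) t)) has_sum
      t powr (\<delta> - 1) * mittag_leffler3 a1 a2 a3 \<delta>
        (c1 * t powr a1) (c2 * t powr a2) (c3 * t powr a3)) UNIV"
proof -
  show ?abs
  proof (cases "t > 0")
    case False
    then show ?thesis by (simp add: case_prod_unfold)
  next
    case True
    from summable_on_cmult_right[OF mittag_leffler3_summable[OF a \<delta>, of "c1 * t powr a1"
          "c2 * t powr a2" "c3 * t powr a3"], of "t powr (\<delta> - 1)"]
    show ?thesis
      by (simp only: case_prod_unfold frac_kernel_monomial[OF True refl])
         (simp add: abs_mult mult_ac)
  qed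
  assume t: "t > 0"
  from has_sum_cmult_right[OF has_sum_mittag_leffler3[OF a \<delta>, of "c1 * t powr a1"
        "c2 * t powr a2" "c3 * t powr a3"], of "t powr (\<delta> - 1)"]
  show "((\<lambda>(l, p, k). trinomial l p k * (c1 ^ l * c2 ^ p * c3 ^ k *
      frac_kernel (real l * a1 + real p * a2 + real k * a3 + \<delta>) t)) has_sum
      t powr (\<delta> - 1) * mittag_leffler3 a1 a2 a3 \<delta>
        (c1 * t powr a1) (c2 * t powr a2) (c3 * t powr a3)) UNIV"
    by (simp only: case_prod_unfold frac_kernel_monomial[OF t refl]) (simp add: mult_ac)
qed

text \<open>Applying J^d to the equation and using the semigroup law identifies the difference of
  the \<open>b\<close> in \<open>trinomial_telescope\<close> with a single integral of g.
  Convergence comes from \<open>frac_integral_bound\<close> and the kernel series with \<delta> =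
  1.\<close>

lemma frac_integral_series_solution:
  fixes c1 c2 c3 :: real
  assumes a: "a1 > 0" "a2 > 0" "a3 > 0" and \<delta>: "\<delta> > 0"
    and y: "causal y" and g: "causal g"
    and eq: "\<And>s. y s = c1 * frac_integral a1 y s + c2 * frac_integral a2 y s
      + c3 * frac_integral a3 y s + frac_integral \<delta> g s"
    and r: "r > 0"
  shows "((\<lambda>(l, p, k). trinomial l p k * (c1 ^ l * c2 ^ p * c3 ^ k *
      frac_integral (real l * a1 + real p * a2 + real k * a3 + \<delta>) g r)) has_sum y r) UNIV"
proof -
  define d where "d l p k = real l * a1 + real p * a2 + real k * a3" for l p k :: nat
  have d: "d l p k \<ge> 0" for l p k unfolding d_def using a by (intro add_nonneg_nonneg) auto
  define b where "b l p k = c1 ^ l * c2 ^ p * c3 ^ k * frac_integral (d l p k) y r" for l p k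
  obtain M where M: "M \<ge> 0" "\<And>x. x \<le> r \<Longrightarrow> \<bar>y x\<bar> \<le> M" using causal_boundE[OF y] by metis
  have "(\<lambda>(l, p, k). \<bar>trinomial l p k * b l p k\<bar>) summable_on UNIV"
  proof (rule summable_on_comparison_test)
    show "(\<lambda>(l, p, k). M * \<bar>trinomial l p k * (c1 ^ l * c2 ^ p * c3 ^ k *
      frac_kernel (real l * a1 + real p * a2 + real k * a3 + 1) r)\<bar>) summable_on UNIV"
      using summable_on_cmult_right[OF frac_kernel_series(1)[OF a zero_less_one], of M c1 c2 c3 r]
      by (simp add: case_prod_unfold)
    have "\<bar>trinomial l p k * b l p k\<bar> \<le> M * \<bar>trinomial l p k * (c1 ^ l * c2 ^ p * c3 ^ k *
      frac_kernel (d l p k + 1) r)\<bar>" for l p k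
    proof -
      have "\<bar>frac_integral (d l p k) y r\<bar> \<le> M * \<bar>frac_kernel (d l p k + 1) r\<bar>"
        using frac_integral_bound[OF y d M(2) r, of l p k] d[of l p k]
          frac_kernel_nonneg[of "d l p k + 1" r] by simp
      from mult_left_mono[OF this, of "\<bar>trinomial l p k * (c1 ^ l * c2 ^ p * c3 ^ k)\<bar>"]
      show ?thesis by (simp add: b_def abs_mult mult_ac)
    qed
    then show "(case x of (l, p, k) \<Rightarrow> \<bar>trinomial l p k * b l p k\<bar>) \<le>
      (case x of (l, p, k) \<Rightarrow> M * \<bar>trinomial l p k * (c1 ^ l * c2 ^ p * c3 ^ k *
        frac_kernel (real l * a1 + real p * a2 + real k * a3 + 1) r)\<bar>)" for x
      by (simp add: d_def split: prod.split)
  qed auto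
  from trinomial_telescope[OF this]
  \<comment> \<open>The surviving \<open>b 0 0 0\<close> is the integral of order 0 of y, that is
    \<open>y r\<close>.\<close>
  have "((\<lambda>(l, p, k). trinomial l p k *
      (b l p k - b (Suc l) p k - b l (Suc p) k - b l p (Suc k))) has_sum y r) UNIV"
    by (simp add: b_def d_def frac_integral_def)
  moreover have "b l p k - b (Suc l) p k - b l (Suc p) k - b l p (Suc k) =
      c1 ^ l * c2 ^ p * c3 ^ k * frac_integral (d l p k + \<delta>) g r" for l p k
  proof -
    define x where "x = d l p k"
    have x: "x \<ge> 0" using d by (simp add: x_def)
    \<comment> \<open>Linearity of J^x needs integrability for x > 0, whereas for x = 0 it is the
      equation itself.\<close>
    have lin: "frac_integral x y r = c1 * frac_integral x (frac_integral a1 y) r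
      + c2 * frac_integral x (frac_integral a2 y) r + c3 * frac_integral x (frac_integral a3 y) r
      + frac_integral x (frac_integral \<delta> g) r"
    proof (cases "x = 0")
      case True
      then show ?thesis using eq[of r] by (simp add: frac_integral_def[of 0])
    next
      case False
      with x have "x > 0" by simp
      note int = frac_integral_integrable[OF y this, of a1 r] frac_integral_integrable[OF y this, of a2 r]
        frac_integral_integrable[OF y this, of a3 r] frac_integral_integrable[OF g this, of \<delta> r]
      have "(LINT s|lborel. frac_kernel x (r - s) * y s) =
         (LINT s|lborel. c1 * (frac_kernel x (r - s) * frac_integral a1 y s)
           + c2 * (frac_kernel x (r - s) * frac_integral a2 y s)
           + c3 * (frac_kernel x (r - s) * frac_integral a3 y s)
           + frac_kernel x (r - s) * frac_integral \<delta> g s)"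
        by (subst eq) (simp add: algebra_simps)
      also have "\<dots> = c1 * (LINT s|lborel. frac_kernel x (r - s) * frac_integral a1 y s)
           + c2 * (LINT s|lborel. frac_kernel x (r - s) * frac_integral a2 y s)
           + c3 * (LINT s|lborel. frac_kernel x (r - s) * frac_integral a3 y s)
           + (LINT s|lborel. frac_kernel x (r - s) * frac_integral \<delta> g s)"
        using int a \<delta> by simp
      finally show ?thesis using False by (simp add: frac_integral_def[of x])
    qed
    have "frac_integral x y r = c1 * frac_integral (x + a1) y r
      + c2 * frac_integral (x + a2) y r + c3 * frac_integral (x + a3) y r
      + frac_integral (x + \<delta>) g r"
      unfolding lin using frac_integral_semigroup[OF y x] frac_integral_semigroup[OF g x] a \<delta> by simp
    moreover have "d (Suc l) p k = x + a1" "d l (Suc p) k = x + a2" "d l p (Suc k) = x + a3"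
      by (simp_all add: d_def x_def algebra_simps)
    ultimately show ?thesis unfolding b_def x_def[symmetric] by (simp add: algebra_simps)
  qed
  ultimately show ?thesis by (simp add: d_def)
qed

text \<open>Sum and integral are interchanged by absolute convergence: the integrals of the norms
  are bounded by M times kernels of order one higher, whose weighted series converges.\<close>

lemma mittag_leffler3_kernel_has_integral:
  fixes c1 c2 c3 :: real
  assumes a: "a1 > 0" "a2 > 0" "a3 > 0" and \<delta>: "\<delta> > 0" and g: "causal g" and r: "r > 0"
    and z: "((\<lambda>(l, p, k). trinomial l p k * (c1 ^ l * c2 ^ p * c3 ^ k *
      frac_integral (real l * a1 + real p * a2 + real k * a3 + \<delta>) g r)) has_sum z) UNIV"
  shows "((\<lambda>s. (r - s) powr (\<delta> - 1) * mittag_leffler3 a1 a2 a3 \<delta>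
      (c1 * (r - s) powr a1) (c2 * (r - s) powr a2) (c3 * (r - s) powr a3) * g s) has_integral z) {0..r}"
proof -
  \<comment> \<open>\<open>integral_suminf\<close> handles series over the naturals, so the triples
    are enumerated by a bijection.\<close>
  obtain e :: "nat \<Rightarrow> nat \<times> nat \<times> nat" where e: "bij_betw e UNIV UNIV"
    using bij_betw_from_nat_into[of "UNIV :: (nat \<times> nat \<times> nat) set"] by (auto simp: finite_prod)
  define d where "d = (\<lambda>(l, p, k). real l * a1 + real p * a2 + real k * a3 + \<delta>)"
  define c where "c = (\<lambda>(l, p, k). trinomial l p k * (c1 ^ l * c2 ^ p * c3 ^ k))"
  have d: "d x > 0" for x unfolding d_def using a \<delta>
    by (cases x) (auto intro!: add_nonneg_pos add_nonneg_nonneg)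
  define f where "f i s = c (e i) * (frac_kernel (d (e i)) (r - s) * g s)" for i s
  define S where "S s = (r - s) powr (\<delta> - 1) * mittag_leffler3 a1 a2 a3 \<delta>
      (c1 * (r - s) powr a1) (c2 * (r - s) powr a2) (c3 * (r - s) powr a3)" for s
  \<comment> \<open>Used with \<epsilon> = 0 for pointwise summability and with \<epsilon> = 1 for
    the integrals of the norms.\<close>
  have abs_summable: "summable (\<lambda>i. \<bar>c (e i)\<bar> * frac_kernel (d (e i) + \<epsilon>) t)" if "\<epsilon> \<ge> 0" for \<epsilon> t
  proof -
    have "(\<lambda>x. \<bar>c x\<bar> * frac_kernel (d x + \<epsilon>) t) = (\<lambda>(l, p, k). \<bar>trinomial l p k *
        (c1 ^ l * c2 ^ p * c3 ^ k * frac_kernel (real l * a1 + real p * a2 + real k * a3 + (\<delta> + \<epsilon>)) t)\<bar>)"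
    proof
      fix x
      have "frac_kernel (d x + \<epsilon>) t \<ge> 0" using d[of x] that by (intro frac_kernel_nonneg) simp
      then show "\<bar>c x\<bar> * frac_kernel (d x + \<epsilon>) t = (case x of (l, p, k) \<Rightarrow> \<bar>trinomial l p k *
        (c1 ^ l * c2 ^ p * c3 ^ k * frac_kernel (real l * a1 + real p * a2 + real k * a3 + (\<delta> + \<epsilon>)) t)\<bar>)"
        by (cases x) (simp add: c_def d_def abs_mult add_ac mult_ac)
    qed
    then have "(\<lambda>x. \<bar>c x\<bar> * frac_kernel (d x + \<epsilon>) t) summable_on UNIV"
      using frac_kernel_series(1)[OF a, of "\<delta> + \<epsilon>" c1 c2 c3 t] \<delta> that by simp
    then show ?thesis
      using summable_on_reindex_bij_betw[OF e, of "\<lambda>x. \<bar>c x\<bar> * frac_kernel (d x + \<epsilon>) t"]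
      by (intro summable_on_imp_summable) simp
  qed
  have int: "integrable lborel (f i)" for i
    unfolding f_def by (intro integrable_mult_right frac_kernel_integrable g d)
  have sum1: "AE s in lborel. summable (\<lambda>i. norm (f i s))"
  proof (rule AE_I2)
    fix s
    have "norm (f i s) = \<bar>g s\<bar> * (\<bar>c (e i)\<bar> * frac_kernel (d (e i) + 0) (r - s))" for i
      using frac_kernel_nonneg[OF d[of "e i"], of "r - s"] by (simp add: f_def abs_mult)
    then show "summable (\<lambda>i. norm (f i s))"
      using summable_mult[OF abs_summable[of 0 "r - s"]] by simp
  qed
  obtain M where M: "M \<ge> 0" "\<And>x. x \<le> r \<Longrightarrow> \<bar>g x\<bar> \<le> M" using causal_boundE[OF g] by metis
  have sum2: "summable (\<lambda>i. LINT s|lborel. norm (f i s))"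
  proof (rule summable_comparison_test')
    show "summable (\<lambda>i. M * (\<bar>c (e i)\<bar> * frac_kernel (d (e i) + 1) r))"
      by (intro summable_mult abs_summable) simp
    fix i :: nat assume "i \<ge> 0"
    have "(LINT s|lborel. norm (f i s)) = \<bar>c (e i)\<bar> * (LINT s|lborel. \<bar>frac_kernel (d (e i)) (r - s) * g s\<bar>)"
      by (simp add: f_def abs_mult)
    also have "\<dots> \<le> \<bar>c (e i)\<bar> * (M * frac_kernel (d (e i) + 1) r)"
      by (intro mult_left_mono frac_integral_norm_bound g d M) auto
    finally show "norm (LINT s|lborel. norm (f i s)) \<le> M * (\<bar>c (e i)\<bar> * frac_kernel (d (e i) + 1) r)"
      by (simp add: mult_ac)
  qed
  have "(\<lambda>i. LINT s|lborel. f i s) sums z"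
  proof -
    have "(LINT s|lborel. f i s) = c (e i) * frac_integral (d (e i)) g r" for i
      using d[of "e i"] by (simp add: f_def frac_integral_def)
    then have "(LINT s|lborel. f i s) = (case e i of (l, p, k) \<Rightarrow> trinomial l p k * (c1 ^ l * c2 ^ p * c3 ^ k *
      frac_integral (real l * a1 + real p * a2 + real k * a3 + \<delta>) g r))" for i
      by (simp add: c_def d_def mult.assoc split: prod.split)
    moreover have "((\<lambda>i. case e i of (l, p, k) \<Rightarrow> trinomial l p k * (c1 ^ l * c2 ^ p * c3 ^ k *
      frac_integral (real l * a1 + real p * a2 + real k * a3 + \<delta>) g r)) has_sum z) UNIV"
      using z has_sum_reindex_bij_betw[OF e] by blast
    ultimately show ?thesis by (simp add: has_sum_imp_sums)
  qed
  then have "(LINT s|lborel. (\<Sum>i. f i s)) = z"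
    using integral_suminf[OF int sum1 sum2] by (simp add: sums_iff)
  then have "((\<lambda>s. \<Sum>i. f i s) has_integral z) UNIV"
    using has_integral_integral_real[OF integrable_suminf[OF int sum1 sum2]] by simp
  also have "(\<lambda>s. \<Sum>i. f i s) = (\<lambda>s. if s \<in> {0..r} then S s * g s else 0)"
  proof
    fix s
    consider "s < 0" | "s \<ge> r" | "s \<ge> 0" "s < r" by linarith
    then show "(\<Sum>i. f i s) = (if s \<in> {0..r} then S s * g s else 0)"
    proof cases
      case 1
      then show ?thesis using g by (simp add: f_def causal_def)
    next
      \<comment> \<open>At s = r both sides are 0, the right one because
        \<open>0 powr (\<delta> - 1)\<close> is 0.\<close>
      case 2
      then show ?thesis by (auto simp: f_def S_def)
    next
      case 3
      have "((\<lambda>x. c x * frac_kernel (d x) (r - s)) has_sum S s) UNIV"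
        using frac_kernel_series(2)[OF a \<delta>, of "r - s" c1 c2 c3] 3
        by (simp add: c_def d_def S_def case_prod_unfold mult_ac)
      then have "((\<lambda>i. c (e i) * frac_kernel (d (e i)) (r - s)) has_sum S s) UNIV"
        using has_sum_reindex_bij_betw[OF e, of "\<lambda>x. c x * frac_kernel (d x) (r - s)"] by simp
      from sums_mult2[OF has_sum_imp_sums[OF this], of "g s"] show ?thesis
        using 3 by (simp add: f_def sums_iff mult.assoc)
    qed
  qed
  finally show ?thesis by (simp only: has_integral_restrict_UNIV S_def)
qed

section \<open>From the Caputo equation to the solution formula\<close>

theorem theorem4p2:
  fixes \<alpha> \<beta> \<gamma> lam1 lam2 lam3 :: real and g y :: "real \<Rightarrow> real"
  assumes "1 \<ge> \<alpha>" and "\<alpha> > \<beta>" and "\<beta> > \<gamma>" and "\<gamma> > 0"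
    and "continuous_on {0..} g"
    and "C1_halfline y"
    and "\<And>r. r > 0 \<Longrightarrow> caputo \<alpha> y r - lam3 * caputo \<beta> y r - lam2 * caputo \<gamma> y r - lam1 * y r = g r"
    and "y 0 = 0"
  shows "\<forall>r\<ge>0. ((\<lambda>s. (r - s) powr (\<alpha> - 1) *
      mittag_leffler3 \<alpha> (\<alpha> - \<gamma>) (\<alpha> - \<beta>) \<alpha>
        (lam1 * (r - s) powr \<alpha>) (lam2 * (r - s) powr (\<alpha> - \<gamma>)) (lam3 * (r - s) powr (\<alpha> - \<beta>)) *
      g s) has_integral y r) {0..r}"
proof (intro allI impI)
  fix r :: real assume "r \<ge> 0"
  obtain v where v: "\<And>r. r \<ge> 0 \<Longrightarrow> (y has_real_derivative v r) (at r within {0..})"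
      "continuous_on {0..} v"
    using assms(6) unfolding C1_halfline_def by blast
  define v0 y0 g0 where "v0 = (\<lambda>x. if x \<ge> 0 then v x else 0)"
    and "y0 = (\<lambda>x. if x \<ge> 0 then y x else 0)" and "g0 = (\<lambda>x. if x \<ge> 0 then g x else 0)"
  have "continuous_on {0..} y"
    using v(1) by (auto simp: continuous_on_eq_continuous_within intro: DERIV_continuous)
  then have causal: "causal v0" "causal y0" "causal g0"
    using causal_extend v(2) assms(5) by (auto simp: v0_def y0_def g0_def)
  have y0: "y0 = frac_integral 1 v0"
    using frac_integral_1_antiderivative[OF v assms(8)] by (simp add: v0_def y0_def fun_eq_iff)
  have \<alpha>: "\<alpha> > 0" using assms by linarith
  \<comment> \<open>Both sides are the integral of order \<alpha> - \<rho> + 1 of \<open>v0\<close>;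
    used for \<rho> = \<alpha>, \<beta>, \<gamma>.\<close>
  have y0_J: "frac_integral \<alpha> (frac_integral (1 - \<rho>) v0) s = frac_integral (\<alpha> - \<rho>) y0 s"
    if "\<rho> \<le> \<alpha>" for \<rho> s
    unfolding y0 using that assms \<alpha> causal(1) by (simp add: frac_integral_semigroup algebra_simps)
  \<comment> \<open>The equation is given only for s > 0, and for s < 0 all terms vanish; the point
    s = 0 is a null set for the integration that follows. Writing y as an integral of order 0 lets
    the same integrability lemma cover every term.\<close>
  have eq: "g0 s = frac_integral (1 - \<alpha>) v0 s - lam3 * frac_integral (1 - \<beta>) v0 s
      - lam2 * frac_integral (1 - \<gamma>) v0 s - lam1 * frac_integral 0 y0 s" if "s \<noteq> 0" for s
  proof (cases "s > 0")
    case True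
    then show ?thesis using assms(7)[of s] caputo_eq_frac_integral[OF v _ True] assms(1-4)
      by (simp add: v0_def y0_def g0_def frac_integral_def[of 0])
  next
    case False
    with that show ?thesis using causal by (simp add: frac_integral_neg g0_def)
  qed
  have "frac_integral \<alpha> g0 s = frac_integral \<alpha> (frac_integral (1 - \<alpha>) v0) s
      - lam3 * frac_integral \<alpha> (frac_integral (1 - \<beta>) v0) s
      - lam2 * frac_integral \<alpha> (frac_integral (1 - \<gamma>) v0) s
      - lam1 * frac_integral \<alpha> (frac_integral 0 y0) s" for s
  proof -
    note int = frac_integral_integrable[OF causal(1) \<alpha>, of "1 - \<alpha>" s]
      frac_integral_integrable[OF causal(1) \<alpha>, of "1 - \<beta>" s]
      frac_integral_integrable[OF causal(1) \<alpha>, of "1 - \<gamma>" s]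
      frac_integral_integrable[OF causal(2) \<alpha>, of 0 s]
    have "(LINT t|lborel. frac_kernel \<alpha> (s - t) * g0 t) =
       (LINT t|lborel. frac_kernel \<alpha> (s - t) * frac_integral (1 - \<alpha>) v0 t
         - lam3 * (frac_kernel \<alpha> (s - t) * frac_integral (1 - \<beta>) v0 t)
         - lam2 * (frac_kernel \<alpha> (s - t) * frac_integral (1 - \<gamma>) v0 t)
         - lam1 * (frac_kernel \<alpha> (s - t) * frac_integral 0 y0 t))"
    proof (rule integral_cong_AE)
      show "(\<lambda>t. frac_kernel \<alpha> (s - t) * g0 t) \<in> borel_measurable lborel"
        using frac_kernel_integrable[OF causal(3) \<alpha>] by (rule borel_measurable_integrable)
      show "AE t in lborel. frac_kernel \<alpha> (s - t) * g0 t =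
         frac_kernel \<alpha> (s - t) * frac_integral (1 - \<alpha>) v0 t
         - lam3 * (frac_kernel \<alpha> (s - t) * frac_integral (1 - \<beta>) v0 t)
         - lam2 * (frac_kernel \<alpha> (s - t) * frac_integral (1 - \<gamma>) v0 t)
         - lam1 * (frac_kernel \<alpha> (s - t) * frac_integral 0 y0 t)"
        using AE_lborel_singleton[of 0]
        by (rule eventually_mono) (simp add: eq algebra_simps)
    qed (use int assms in \<open>auto intro!: borel_measurable_integrable\<close>)
    also have "\<dots> = (LINT t|lborel. frac_kernel \<alpha> (s - t) * frac_integral (1 - \<alpha>) v0 t)
         - lam3 * (LINT t|lborel. frac_kernel \<alpha> (s - t) * frac_integral (1 - \<beta>) v0 t)
         - lam2 * (LINT t|lborel. frac_kernel \<alpha> (s - t) * frac_integral (1 - \<gamma>) v0 t)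
         - lam1 * (LINT t|lborel. frac_kernel \<alpha> (s - t) * frac_integral 0 y0 t)"
      using int assms by simp
    finally show ?thesis using \<alpha> by (simp add: frac_integral_def[of \<alpha>])
  qed
  \<comment> \<open>With \<rho> = \<alpha>, \<open>y0_J\<close> turns the leading term into an
    integral of order 0, which is \<open>y0 s\<close>.\<close>
  then have "y0 s = lam1 * frac_integral \<alpha> y0 s + lam2 * frac_integral (\<alpha> - \<gamma>) y0 s
      + lam3 * frac_integral (\<alpha> - \<beta>) y0 s + frac_integral \<alpha> g0 s" for s
    using assms(2-4) \<alpha> causal(2)
    by (simp add: y0_J frac_integral_semigroup frac_integral_def[of 0])
  note sol = mittag_leffler3_kernel_has_integral[OF _ _ _ \<alpha> causal(3) _
      frac_integral_series_solution[OF _ _ _ \<alpha> causal(2,3) this]]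
  show "((\<lambda>s. (r - s) powr (\<alpha> - 1) *
      mittag_leffler3 \<alpha> (\<alpha> - \<gamma>) (\<alpha> - \<beta>) \<alpha>
        (lam1 * (r - s) powr \<alpha>) (lam2 * (r - s) powr (\<alpha> - \<gamma>)) (lam3 * (r - s) powr (\<alpha> - \<beta>)) *
      g s) has_integral y r) {0..r}"
  proof (cases "r = 0")
    case True
    then show ?thesis using assms(8) has_integral_refl(2)[of _ "0::real"] by simp
  next
    case False
    with \<open>r \<ge> 0\<close> have "r > 0" by simp
    then have "((\<lambda>s. (r - s) powr (\<alpha> - 1) *
        mittag_leffler3 \<alpha> (\<alpha> - \<gamma>) (\<alpha> - \<beta>) \<alpha>
          (lam1 * (r - s) powr \<alpha>) (lam2 * (r - s) powr (\<alpha> - \<gamma>)) (lam3 * (r - s) powr (\<alpha> - \<beta>)) *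
        g0 s) has_integral y0 r) {0..r}"
      using assms(2-4) \<alpha> by (intro sol) auto
    then show ?thesis
      using \<open>r > 0\<close> by (simp add: y0_def) (erule has_integral_eq[rotated], simp add: g0_def)
  qed
qed

end
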